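(* Let $(K,\partial)$ be a complex and let $(\mathtt g_i)_{i\le\beta_q}$ be an explicit $q$-homology basis for $(K,\partial)$. Then there exists a perfect HDVF $X=(P,S,C)$ for $(K,\partial)$, with associated reduction $(f,g,h)$, such that $\big(g_q(\gamma)\big)_{\gamma\in C_q}=(\mathtt g_i)_{i\le\beta_q}$ (i.e. there is a bijection $i\mapsto\gamma_i$ from $\{1,\dots,\beta_q\}$ to $C_q$ with $g_q(\gamma_i)=\mathtt g_i$ for all $i$).
   Context: Coefficients are in $\mathcal F=\mathbb{Z}/2\mathbb{Z}$. A complex $(K,\partial)$ is the chain complex of a finite cellular complex of dimension $n$: for $0\le q\le n$, $K_q$ is the $\mathcal F$-vector space with basis the finite set $\overline{K_q}$ of $q$-cells, and $\partial_q:K_q\to K_{q-1}$ is the cellular boundary map, with $\partial_q\partial_{q+1}=0$ and $\partial_0=0$. Write $K=\bigoplus_q K_q$, $\partial=\bigoplus_q\partial_q$, and $\overline K=\bigcup_q\overline{K_q}$ for the set of all cells. $H_q(K)=\ker\partial_q/\operatorname{im}\partial_{q+1}$ and $\beta_q=\dim H_q(K)$. For a set of cells $A$, $\mathtt i_A:\operatorname{Span}A\to K$ is the inclusion, $\mathtt j_A:K\to\operatorname{Span}A$ the coordinate projection, $A_q$ the set of $q$-cells in $A$, and $\partial_{AB}=\mathtt j_B\circ\partial\circ\mathtt i_A$. HDVF: a homological discrete vector field (HDVF) for $(K,\partial)$ is a triple $X=(P,S,C)$ forming a partition of $\overline K$ (parts may be empty) such that $\partial_{SP}:\operatorname{Span}S\to\operatorname{Span}P$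 is invertible. Put $H=(\partial_{SP})^{-1}$, $F=-\partial_{SC}H$, $G=-H\partial_{CP}$. Its associated reduction $(f,g,h)$ consists of $g=\mathtt i_C+\mathtt i_S G:\operatorname{Span}C\to K$, $f=F\,\mathtt j_P+\mathtt j_C:K\to\operatorname{Span}C$, $h=\mathtt i_S H\,\mathtt j_P:K\to K$ (of degree $+1$), with reduced boundary $d=\partial_{CC}-\partial_{SC}H\partial_{CP}$. The HDVF is perfect if $d=0$; in that case $(g_q(\gamma))_{\gamma\in C_q}$ is a $q$-homology basis, where $g_q$ is the restriction of $g$ to $\operatorname{Span}C_q$. A $q$-homology basis of $(K,\partial)$ is a family $(\mathtt g_i)_{i\le\beta}$ of $q$-cycles (elements of $\ker\partial_q$) whose classes form a basis of $H_q(K)$. Explicit bases: for a chain $x$, $\overline x$ is the set of cells with nonzero coefficient in $x$. For a set of cells $A$, $(K(A),\partial)$ is the smallest sub-complex (spanned by cells) containing $A$; it is spanned by the cells of $A$ and all their faces. For a $q$-homology basis $(\mathtt g_i)_{i\le\beta}$, put $K^\beta=K\big(\bigcup_{i\le\beta}\overline{\mathtt g_i}\big)$. The basis is explicit if for all $k$, $\overline{\mathtt g_k}\setminus\bigcup_{i\ne k}\overline{\mathtt g_i}\neq\emptyset$, and $\dim H_q(K^\beta)=\beta$. *)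

theory Defs
  imports
    "HOL-Algebra.AbelCoset"
    "Jordan_Normal_Form.VS_Connect"
    "HOL-Library.Z2"
    "HOL-Library.Function_Algebras"
begin

section \<open>Chains with coefficients in the two-element field\<close>

type_synonym 'c chain = "'c \<Rightarrow> bit"

definition supp :: "'c chain \<Rightarrow> 'c set" where
  "supp x = {\<sigma>. x \<sigma> \<noteq> 0}"

definition single :: "'c \<Rightarrow> 'c chain" where
  "single \<sigma> = (\<lambda>\<tau>. if \<tau> = \<sigma> then 1 else 0)"

text \<open>
  For a finite set of cells \<open>A\<close> this is the space of formal linear combinations of \<open>A\<close>. Chains are
  total functions vanishing off \<open>A\<close>, so the inclusion of \<open>Span A\<close> into a larger space of chains is
  the identity, and the coordinate projection onto it is \<open>proj A\<close>.
\<close>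
definition Span :: "'c set \<Rightarrow> 'c chain set" where
  "Span A = {x. supp x \<subseteq> A}"

definition proj :: "'c set \<Rightarrow> 'c chain \<Rightarrow> 'c chain" where
  "proj A x = (\<lambda>\<sigma>. if \<sigma> \<in> A then x \<sigma> else 0)"

section \<open>Finite cellular complexes\<close>

text \<open>
  A complex is recorded by its cells, their dimensions, and the incidence number modulo 2 of
  a cell \<open>\<sigma>\<close> (first argument of \<open>inc\<close>) on a cell \<open>\<tau>\<close>, i.e. the coefficient of \<open>\<tau>\<close> in the
  boundary of \<open>\<sigma>\<close>. Values of \<open>cdim\<close> and \<open>inc\<close> outside \<open>cells\<close> play no role.
\<close>
record 'c cellular =
  cells :: "'c set"
  cdim :: "'c \<Rightarrow> nat"
  inc :: "'c \<Rightarrow> 'c \<Rightarrow> bit"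

definition qcells :: "'c cellular \<Rightarrow> nat \<Rightarrow> 'c set" where
  "qcells K q = {\<sigma> \<in> cells K. cdim K \<sigma> = q}"

definition bd :: "'c cellular \<Rightarrow> 'c chain \<Rightarrow> 'c chain" where
  "bd K x = (\<lambda>\<tau>. if \<tau> \<in> cells K then (\<Sum>\<sigma>\<in>cells K. x \<sigma> * inc K \<sigma> \<tau>) else 0)"

text \<open>
  The degree condition says that \<open>bd K\<close> maps \<open>q\<close>-chains to \<open>(q - 1)\<close>-chains and
  vanishes on \<open>0\<close>-chains.
\<close>
definition cell_complex :: "nat \<Rightarrow> 'c cellular \<Rightarrow> bool" where
  "cell_complex n K \<longleftrightarrow>
     finite (cells K) \<and>
     (\<forall>\<sigma>\<in>cells K. cdim K \<sigma> \<le> n) \<and>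
     (\<forall>\<sigma>\<in>cells K. \<forall>\<tau>\<in>cells K. inc K \<sigma> \<tau> \<noteq> 0 \<longrightarrow> cdim K \<sigma> = Suc (cdim K \<tau>)) \<and>
     (\<forall>x\<in>Span (cells K). bd K (bd K x) = 0)"

text \<open>
  The smallest subcomplex spanned by cells and containing \<open>A\<close>. Since its cells are closed under
  taking boundaries, \<open>bd\<close> of the result is the restriction of \<open>bd K\<close>.
\<close>
definition subcomplex :: "'c cellular \<Rightarrow> 'c set \<Rightarrow> 'c cellular" where
  "subcomplex K A = K\<lparr>cells :=
     \<Inter>{B. A \<subseteq> B \<and> B \<subseteq> cells K \<and> (\<forall>\<sigma>\<in>B. supp (bd K (single \<sigma>)) \<subseteq> B)}\<rparr>"

section \<open>Homology\<close>

text \<open>The ring components \<open>mult\<close> and \<open>one\<close> of a module record are not used.\<close>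

definition chain_vs :: "'c chain set \<Rightarrow> (bit, 'c chain) module" where
  "chain_vs Z = \<lparr>carrier = Z, mult = undefined, one = undefined, zero = 0, add = (+),
     smult = (\<lambda>c x \<sigma>. c * x \<sigma>)\<rparr>"

definition quot_vs :: "('a, 'b, 'm) module_scheme \<Rightarrow> 'b set \<Rightarrow> ('a, 'b set) module" where
  "quot_vs V W = \<lparr>carrier = a_rcosets\<^bsub>V\<^esub> W, mult = undefined, one = undefined,
     zero = W, add = (<+>\<^bsub>V\<^esub>),
     smult = (\<lambda>c X. \<Union>x\<in>X. W +>\<^bsub>V\<^esub> (c \<odot>\<^bsub>V\<^esub> x))\<rparr>"

definition cycles :: "'c cellular \<Rightarrow> nat \<Rightarrow> 'c chain set" where
  "cycles K q = {x \<in> Span (qcells K q). bd K x = 0}"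

definition boundaries :: "'c cellular \<Rightarrow> nat \<Rightarrow> 'c chain set" where
  "boundaries K q = bd K ` Span (qcells K (Suc q))"

definition homology :: "'c cellular \<Rightarrow> nat \<Rightarrow> (bit, 'c chain set) module" where
  "homology K q = quot_vs (chain_vs (cycles K q)) (boundaries K q)"

definition hclass :: "'c cellular \<Rightarrow> nat \<Rightarrow> 'c chain \<Rightarrow> 'c chain set" where
  "hclass K q x = boundaries K q +>\<^bsub>chain_vs (cycles K q)\<^esub> x"

definition betti :: "'c cellular \<Rightarrow> nat \<Rightarrow> nat" where
  "betti K q = vectorspace.dim class_ring (homology K q)"

definition homology_basis :: "'c cellular \<Rightarrow> nat \<Rightarrow> (nat \<Rightarrow> 'c chain) \<Rightarrow> bool" where
  "homology_basis K q b \<longleftrightarrow>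
     (\<forall>i\<in>{1..betti K q}. b i \<in> cycles K q) \<and>
     inj_on (\<lambda>i. hclass K q (b i)) {1..betti K q} \<and>
     vectorspace.basis class_ring (homology K q) ((\<lambda>i. hclass K q (b i)) ` {1..betti K q})"

definition explicit_homology_basis :: "'c cellular \<Rightarrow> nat \<Rightarrow> (nat \<Rightarrow> 'c chain) \<Rightarrow> bool" where
  "explicit_homology_basis K q b \<longleftrightarrow>
     homology_basis K q b \<and>
     (\<forall>k\<in>{1..betti K q}. supp (b k) - (\<Union>i\<in>{1..betti K q} - {k}. supp (b i)) \<noteq> {}) \<and>
     betti (subcomplex K (\<Union>i\<in>{1..betti K q}. supp (b i))) q = betti K q"

section \<open>Homological discrete vector fields\<close>

text \<open>The block of the boundary map from \<open>Span A\<close> to \<open>Span B\<close>; \<open>A\<close> only marks the intended domain.\<close>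
definition bd_block :: "'c cellular \<Rightarrow> 'c set \<Rightarrow> 'c set \<Rightarrow> 'c chain \<Rightarrow> 'c chain" where
  "bd_block K A B x = proj B (bd K x)"

type_synonym 'c triple = "'c set \<times> 'c set \<times> 'c set"

text \<open>
  As \<open>bd_block K S P\<close> is linear, it is invertible as a linear map from \<open>Span S\<close> to \<open>Span P\<close>
  iff it is bijective.
\<close>
definition hdvf :: "'c cellular \<Rightarrow> 'c triple \<Rightarrow> bool" where
  "hdvf K = (\<lambda>(P, S, C).
     P \<union> S \<union> C = cells K \<and> P \<inter> S = {} \<and> P \<inter> C = {} \<and> S \<inter> C = {} \<and>
     bij_betw (bd_block K S P) (Span S) (Span P))"

definition hdvf_H :: "'c cellular \<Rightarrow> 'c triple \<Rightarrow> 'c chain \<Rightarrow> 'c chain" where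
  "hdvf_H K = (\<lambda>(P, S, C). inv_into (Span S) (bd_block K S P))"

definition hdvf_F :: "'c cellular \<Rightarrow> 'c triple \<Rightarrow> 'c chain \<Rightarrow> 'c chain" where
  "hdvf_F K = (\<lambda>(P, S, C) x. - bd_block K S C (hdvf_H K (P, S, C) x))"

definition hdvf_G :: "'c cellular \<Rightarrow> 'c triple \<Rightarrow> 'c chain \<Rightarrow> 'c chain" where
  "hdvf_G K = (\<lambda>(P, S, C) x. - hdvf_H K (P, S, C) (bd_block K C P x))"

text \<open>
  The triple \<open>(f, g, h)\<close>; \<open>f\<close> and \<open>h\<close> are meant on \<open>Span (cells K)\<close>, \<open>g\<close> on \<open>Span C\<close>.
\<close>
definition hdvf_reduction ::
  "'c cellular \<Rightarrow> 'c triple \<Rightarrow>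
     ('c chain \<Rightarrow> 'c chain) \<times> ('c chain \<Rightarrow> 'c chain) \<times> ('c chain \<Rightarrow> 'c chain)" where
  "hdvf_reduction K = (\<lambda>(P, S, C).
     (\<lambda>x. hdvf_F K (P, S, C) (proj P x) + proj C x,
      \<lambda>x. x + hdvf_G K (P, S, C) x,
      \<lambda>x. hdvf_H K (P, S, C) (proj P x)))"

definition hdvf_d :: "'c cellular \<Rightarrow> 'c triple \<Rightarrow> 'c chain \<Rightarrow> 'c chain" where
  "hdvf_d K = (\<lambda>(P, S, C) x.
     bd_block K C C x - bd_block K S C (hdvf_H K (P, S, C) (bd_block K C P x)))"

definition perfect_hdvf :: "'c cellular \<Rightarrow> 'c triple \<Rightarrow> bool" where
  "perfect_hdvf K = (\<lambda>(P, S, C). hdvf K (P, S, C) \<and> (\<forall>x\<in>Span C. hdvf_d K (P, S, C) x = 0))"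

end

theory Submission
  imports Defs
begin

text \<open>
  Let \<open>A\<close> be the union of the supports of the \<open>b i\<close> and choose in each support a private cell
  \<open>\<gamma> i\<close>. The dimension condition says that every cycle supported in \<open>A\<close> is a sum of the \<open>b i\<close>.
  Hence no nonzero boundary is supported in \<open>A\<close>, so \<open>P\<close> can be chosen outside \<open>A\<close> such that
  the projection is a bijection from the space of boundaries onto \<open>Span P\<close>; then \<open>Span (cells K - P)\<close>
  is a complement of the boundaries and still has every boundary as an image. Moreover no nonzero cycle
  is supported in \<open>A\<close> minus the cells \<open>\<gamma> i\<close>, so this difference extends to a set \<open>S\<close> of cells outside
  \<open>P\<close> whose boundaries form a basis of all boundaries. With \<open>C\<close> the remaining cells, \<open>g\<close> sends
  \<open>c \<in> C\<close> to the unique cycle in \<open>c + Span S\<close>, which for \<open>c = \<gamma> i\<close> is \<open>b i\<close>. There are no further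
  \<open>q\<close>-cells in \<open>C\<close>: the cycle of such a cell avoids \<open>P\<close>, so it is a sum of the \<open>b i\<close> without
  any boundary term.
\<close>

section \<open>Chains modulo 2\<close>

lemma chain_add_self [simp]: "(x :: 'c chain) + x = 0"
  by (rule ext) simp

lemma chain_minus_eq_add: "(x :: 'c chain) - y = x + y"
  by (rule ext) simp

lemma chain_uminus_eq [simp]: "- (x :: 'c chain) = x"
  by (rule ext) simp

lemma chain_add_eq_0_iff: "(x :: 'c chain) + y = 0 \<longleftrightarrow> x = y"
  using chain_minus_eq_add[of x y] by (metis eq_iff_diff_eq_0)

lemma chain_sum_apply: "(\<Sum>i\<in>T. b i :: 'c chain) \<sigma> = (\<Sum>i\<in>T. b i \<sigma>)"
  by (induction T rule: infinite_finite_induct) auto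

lemma smult_chain_vs: "c \<odot>\<^bsub>chain_vs Z\<^esub> x = (if c = 0 then 0 else x)"
  by (cases "c = 0") (auto simp: chain_vs_def fun_eq_iff)

text \<open>These rules would replace the field operations of type \<open>bit\<close> by the bitwise ones.\<close>

declare mult_bit_eq_and [simp del] add_bit_eq_xor [simp del]

text \<open>Over the two-element field, containing 0 and being closed under addition is all that a
  linear subspace requires.\<close>

definition add_closed :: "'c chain set \<Rightarrow> bool" where
  "add_closed Z \<longleftrightarrow> 0 \<in> Z \<and> (\<forall>x\<in>Z. \<forall>y\<in>Z. x + y \<in> Z)"

lemma add_closed_zero: "add_closed Z \<Longrightarrow> 0 \<in> Z"
  and add_closed_add: "add_closed Z \<Longrightarrow> x \<in> Z \<Longrightarrow> y \<in> Z \<Longrightarrow> x + y \<in> Z"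
  by (auto simp: add_closed_def)

lemma add_closed_sum:
  "add_closed Z \<Longrightarrow> (\<And>i. i \<in> T \<Longrightarrow> b i \<in> Z) \<Longrightarrow> (\<Sum>i\<in>T. b i) \<in> Z"
  by (induction T rule: infinite_finite_induct) (auto simp: add_closed_def simp del: plus_fun_apply)

section \<open>Quotients of chain spaces\<close>

text \<open>Instantiated with cycles and boundaries, both of \<open>K\<close> and of the subcomplex
  carrying the basis, so that \<open>Q\<close> becomes homology in one fixed degree.\<close>

locale chain_quotient =
  fixes Z W :: "'c chain set"
  assumes Z: "add_closed Z" and W: "add_closed W" and WZ: "W \<subseteq> Z"
begin

abbreviation Q :: "(bit, 'c chain set) module" where
  "Q \<equiv> quot_vs (chain_vs Z) W"

abbreviation cls :: "'c chain \<Rightarrow> 'c chain set" where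
  "cls x \<equiv> W +>\<^bsub>chain_vs Z\<^esub> x"

lemma cls_eq: "cls x = (\<lambda>w. w + x) ` W"
  by (auto simp: a_r_coset_def' chain_vs_def)

lemma mem_cls_iff: "y \<in> cls x \<longleftrightarrow> y + x \<in> W"
proof
  assume "y + x \<in> W"
  then have "y + x + x \<in> cls x" unfolding cls_eq by blast
  then show "y \<in> cls x" by (simp add: add.assoc)
qed (auto simp: cls_eq add.assoc)

lemma cls_eq_iff: "cls x = cls y \<longleftrightarrow> x + y \<in> W"
proof
  assume "cls x = cls y"
  moreover have "x \<in> cls x" using W by (simp add: mem_cls_iff add_closed_zero)
  ultimately show "x + y \<in> W" by (simp add: mem_cls_iff)
next
  assume xy: "x + y \<in> W"
  have "z + x \<in> W \<longleftrightarrow> z + y \<in> W" for z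
  proof -
    have "z + x + (x + y) = z + y" "z + y + (x + y) = z + x"
      by (auto simp: fun_eq_iff algebra_simps)
    then show ?thesis by (metis W add_closed_add xy)
  qed
  then show "cls x = cls y" by (auto simp: mem_cls_iff)
qed

lemma cls_zero: "cls 0 = W"
  by (simp add: cls_eq)

lemma zero_Q: "\<zero>\<^bsub>Q\<^esub> = cls 0"
  by (simp add: cls_zero quot_vs_def)

lemma carrier_Q: "carrier Q = cls ` Z"
  by (auto simp: quot_vs_def A_RCOSETS_def RCOSETS_def a_r_coset_def chain_vs_def)

lemma add_Q: "cls x \<oplus>\<^bsub>Q\<^esub> cls y = cls (x + y)"
proof -
  have "cls x \<oplus>\<^bsub>Q\<^esub> cls y = (\<Union>h\<in>cls x. \<Union>k\<in>cls y. {h + k})"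
    by (simp add: quot_vs_def set_add_def' chain_vs_def)
  also have "\<dots> = cls (x + y)"
  proof (intro equalityI subsetI)
    fix z assume "z \<in> (\<Union>h\<in>cls x. \<Union>k\<in>cls y. {h + k})"
    then obtain h k where "h + x \<in> W" "k + y \<in> W" and z: "z = h + k"
      by (auto simp: mem_cls_iff)
    then have "(h + x) + (k + y) \<in> W" using W add_closed_add by blast
    then show "z \<in> cls (x + y)" by (simp add: mem_cls_iff z algebra_simps)
  next
    fix z assume "z \<in> cls (x + y)"
    then have "z + y \<in> cls x" by (simp add: mem_cls_iff algebra_simps)
    moreover have "y \<in> cls y" using W by (simp add: mem_cls_iff add_closed_zero)
    moreover have "z = (z + y) + y" by (simp add: add.assoc)
    ultimately show "z \<in> (\<Union>h\<in>cls x. \<Union>k\<in>cls y. {h + k})" by blast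
  qed
  finally show ?thesis .
qed

text \<open>The union in \<open>quot_vs\<close> runs over all representatives, but they all yield
  the same coset; the only scalars are 0 and 1.\<close>

lemma smult_Q: "c \<odot>\<^bsub>Q\<^esub> cls x = cls (if c = 0 then 0 else x)"
proof -
  have eq: "c \<odot>\<^bsub>Q\<^esub> cls x = (\<Union>y\<in>cls x. cls (if c = 0 then 0 else y))"
    by (simp add: quot_vs_def smult_chain_vs)
  have x: "x \<in> cls x" using W by (simp add: mem_cls_iff add_closed_zero)
  have "cls (if c = 0 then 0 else y) = cls (if c = 0 then 0 else x)" if "y \<in> cls x" for y
    using that W by (auto simp: mem_cls_iff[of y x] cls_eq_iff add_closed_zero)
  then show ?thesis unfolding eq using x by blast
qed

lemma vectorspace_Q: "vectorspace (class_ring :: bit ring) Q"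
proof -
  have ag: "abelian_group Q"
  proof (rule abelian_groupI)
    fix x assume "x \<in> carrier Q"
    then obtain u where "u \<in> Z" "x = cls u" by (auto simp: carrier_Q)
    then show "\<exists>y\<in>carrier Q. y \<oplus>\<^bsub>Q\<^esub> x = \<zero>\<^bsub>Q\<^esub>"
      by (auto simp: add_Q zero_Q carrier_Q intro!: bexI[of _ u])
  qed (auto simp: carrier_Q add_Q zero_Q add_closed_zero Z add_closed_add ac_simps)
  have "module (class_ring :: bit ring) Q"
  proof (rule Module.moduleI[OF _ ag])
    show "cring (class_ring :: bit ring)"
      by (rule field.axioms(1)[THEN domain.axioms(1), OF class_field])
  next
    fix a b :: bit and X assume "X \<in> carrier Q"
    then obtain x where "X = cls x" by (auto simp: carrier_Q)
    moreover have "(if a + b = 0 then 0 else x) = (if a = 0 then 0 else x) + (if b = 0 then 0 else x)"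
      by (cases a; cases b) auto
    ultimately show "(a \<oplus>\<^bsub>class_ring\<^esub> b) \<odot>\<^bsub>Q\<^esub> X = a \<odot>\<^bsub>Q\<^esub> X \<oplus>\<^bsub>Q\<^esub> b \<odot>\<^bsub>Q\<^esub> X"
      by (simp only: smult_Q add_Q ring_record_simps)
  qed (auto simp: carrier_Q smult_Q add_Q Z add_closed_zero split: if_splits)
  then show ?thesis
    by (simp add: vectorspace_def class_field)
qed


section \<open>Linear combinations of classes as subset sums\<close>

interpretation Q: vectorspace "class_ring :: bit ring" Q
  by (rule vectorspace_Q)

lemma finsum_Q:
  assumes "finite T" "\<And>i. i \<in> T \<Longrightarrow> b i \<in> Z"
  shows "finsum Q (\<lambda>i. cls (b i)) T = cls (\<Sum>i\<in>T. b i)"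
  using assms
proof (induction T rule: finite_induct)
  case empty
  then show ?case by (simp only: Q.M.finsum_empty sum.empty zero_Q)
next
  case (insert i T)
  then have "finsum Q (\<lambda>i. cls (b i)) (insert i T) = cls (b i) \<oplus>\<^bsub>Q\<^esub> finsum Q (\<lambda>i. cls (b i)) T"
    by (intro Q.M.finsum_insert) (auto simp: carrier_Q)
  then show ?case using insert by (simp only: add_Q sum.insert[OF insert(1,2)] insertI2)
qed

text \<open>A coefficient modulo 2 only decides whether a summand occurs, so a combination is a sum
  over a subset of indices. Injectivity allows passing from classes to indices.\<close>

lemma lincomb_Q:
  assumes I: "finite I" "inj_on (\<lambda>i. cls (b i)) I" and b: "\<And>i. i \<in> I \<Longrightarrow> b i \<in> Z"
  shows "Q.lincomb a ((\<lambda>i. cls (b i)) ` I) = cls (\<Sum>i\<in>{i\<in>I. a (cls (b i)) \<noteq> 0}. b i)"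
proof -
  have "Q.lincomb a ((\<lambda>i. cls (b i)) ` I) = finsum Q (\<lambda>i. a (cls (b i)) \<odot>\<^bsub>Q\<^esub> cls (b i)) I"
    unfolding Q.lincomb_def using I b Z
    by (subst Q.M.finsum_reindex) (auto simp: smult_Q carrier_Q add_closed_zero)
  also have "\<dots> = finsum Q (\<lambda>i. cls (if a (cls (b i)) = 0 then 0 else b i)) I"
    by (simp only: smult_Q)
  also have "\<dots> = cls (\<Sum>i\<in>I. if a (cls (b i)) = 0 then 0 else b i)"
    using I b Z by (intro finsum_Q) (auto simp: add_closed_zero)
  also have "(\<Sum>i\<in>I. if a (cls (b i)) = 0 then 0 else b i) = (\<Sum>i\<in>{i\<in>I. a (cls (b i)) \<noteq> 0}. b i)"
    by (subst sum.inter_filter[OF I(1)], rule sum.cong) auto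
  finally show ?thesis .
qed

text \<open>Dependence of classes becomes a nonempty subset sum lying in \<open>W\<close>, a
  condition on chains alone.\<close>

lemma lin_dep_Q_iff:
  assumes I: "finite I" "inj_on (\<lambda>i. cls (b i)) I" and b: "\<And>i. i \<in> I \<Longrightarrow> b i \<in> Z"
  shows "module.lin_dep (class_ring :: bit ring) Q ((\<lambda>i. cls (b i)) ` I) \<longleftrightarrow>
    (\<exists>T\<subseteq>I. T \<noteq> {} \<and> (\<Sum>i\<in>T. b i) \<in> W)"
proof
  assume "Q.lin_dep ((\<lambda>i. cls (b i)) ` I)"
  then obtain a v where a: "Q.lincomb a ((\<lambda>i. cls (b i)) ` I) = \<zero>\<^bsub>Q\<^esub>"
    and v: "v \<in> (\<lambda>i. cls (b i)) ` I" "a v \<noteq> 0"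
    using Q.finite_lin_dep[of "(\<lambda>i. cls (b i)) ` I"] I b by (auto simp: carrier_Q)
  let ?T = "{i\<in>I. a (cls (b i)) \<noteq> 0}"
  have "cls (\<Sum>i\<in>?T. b i) = cls 0"
    using a lincomb_Q[OF I b, of a] by (simp add: zero_Q)
  then have "(\<Sum>i\<in>?T. b i) \<in> W" by (simp only: cls_eq_iff add_0_right)
  moreover have "?T \<noteq> {}" using v by auto
  ultimately show "\<exists>T\<subseteq>I. T \<noteq> {} \<and> (\<Sum>i\<in>T. b i) \<in> W"
    by (intro exI[of _ ?T] conjI) auto
next
  assume "\<exists>T\<subseteq>I. T \<noteq> {} \<and> (\<Sum>i\<in>T. b i) \<in> W"
  then obtain T where T: "T \<subseteq> I" "T \<noteq> {}" "(\<Sum>i\<in>T. b i) \<in> W" by blast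
  have "Q.lincomb (\<lambda>_. 1) ((\<lambda>i. cls (b i)) ` T) = cls (\<Sum>i\<in>T. b i)"
  proof -
    have "finite T" "inj_on (\<lambda>i. cls (b i)) T"
      using T I finite_subset inj_on_subset by blast+
    then show ?thesis using lincomb_Q[of T b "\<lambda>_. 1"] T b by auto
  qed
  also have "\<dots> = \<zero>\<^bsub>Q\<^esub>"
    unfolding zero_Q cls_eq_iff using T by simp
  finally have "Q.lincomb (\<lambda>_. 1) ((\<lambda>i. cls (b i)) ` T) = \<zero>\<^bsub>Q\<^esub>" .
  moreover have "finite T" using T I finite_subset by blast
  moreover obtain t where "t \<in> T" using T by blast
  ultimately show "Q.lin_dep ((\<lambda>i. cls (b i)) ` I)"
    unfolding Q.lin_dep_def using T(1)
    by (intro exI[of _ "(\<lambda>i. cls (b i)) ` T"] exI[of _ "\<lambda>_. 1"] exI[of _ "cls (b t)"]) auto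
qed

text \<open>The counterpart for spanning; the difference of \<open>z\<close> and the subset sum is
  written as a sum, since signs vanish modulo 2.\<close>

lemma span_Q_mem:
  assumes I: "finite I" "inj_on (\<lambda>i. cls (b i)) I" and b: "\<And>i. i \<in> I \<Longrightarrow> b i \<in> Z"
    and basis: "vectorspace.basis (class_ring :: bit ring) Q ((\<lambda>i. cls (b i)) ` I)" and z: "z \<in> Z"
  shows "\<exists>T\<subseteq>I. z + (\<Sum>i\<in>T. b i) \<in> W"
proof -
  have "cls z \<in> Q.span ((\<lambda>i. cls (b i)) ` I)"
    using basis z unfolding Q.basis_def carrier_Q by blast
  then obtain a where "Q.lincomb a ((\<lambda>i. cls (b i)) ` I) = cls z"
    using Q.finite_in_span[of "(\<lambda>i. cls (b i)) ` I" "cls z"] I b by (auto simp: carrier_Q)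
  with lincomb_Q[OF I b, of a] have "cls z = cls (\<Sum>i\<in>{i\<in>I. a (cls (b i)) \<noteq> 0}. b i)"
    by (rule trans[OF sym, rotated])
  then have "z + (\<Sum>i\<in>{i\<in>I. a (cls (b i)) \<noteq> 0}. b i) \<in> W"
    by (rule cls_eq_iff[THEN iffD1])
  then show ?thesis by (intro exI[of _ "{i\<in>I. a (cls (b i)) \<noteq> 0}"]) auto
qed

text \<open>A finite carrier is its own finite generating set.\<close>

lemma fin_dim_Q: "finite Z \<Longrightarrow> vectorspace.fin_dim (class_ring :: bit ring) Q"
proof -
  assume "finite Z"
  moreover have "Q.span (carrier Q) = carrier Q"
    using Q.in_own_span[of "carrier Q"] Q.span_is_subset2[of "carrier Q"] by blast
  ultimately show ?thesis
    unfolding Q.fin_dim_def by (intro exI[of _ "carrier Q"]) (simp add: carrier_Q)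
qed

end

section \<open>Row and column bases\<close>

lemma supp_zero [simp]: "supp 0 = {}"
  by (simp add: supp_def)

lemma supp_add_subset: "supp (x + y) \<subseteq> supp x \<union> supp y"
  by (auto simp: supp_def)

lemma supp_single [simp]: "supp (single \<sigma>) = {\<sigma>}"
  by (auto simp: supp_def single_def)

lemma in_Span_iff: "x \<in> Span A \<longleftrightarrow> (\<forall>\<sigma>. \<sigma> \<notin> A \<longrightarrow> x \<sigma> = 0)"
  by (auto simp: Span_def supp_def)

lemma single_in_Span [simp]: "single \<sigma> \<in> Span A \<longleftrightarrow> \<sigma> \<in> A"
  by (simp add: Span_def)

lemma single_apply: "single \<sigma> \<tau> = (if \<tau> = \<sigma> then 1 else 0)"
  by (simp add: single_def)

lemma Span_mono: "A \<subseteq> B \<Longrightarrow> Span A \<subseteq> Span B"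
  by (auto simp: Span_def)

lemma Span_empty: "Span {} = {0}"
  by (auto simp: Span_def supp_def fun_eq_iff)

lemma add_closed_Span: "add_closed (Span A)"
  by (auto simp: add_closed_def in_Span_iff)

text \<open>A chain modulo 2 is determined by its support, so \<open>supp\<close> embeds
  \<open>Span A\<close> into \<open>Pow A\<close>.\<close>

lemma finite_Span:
  assumes "finite A"
  shows "finite (Span A :: 'c chain set)"
proof (rule inj_on_finite[of supp _ "Pow A"])
  show "inj_on supp (Span A :: 'c chain set)"
  proof (rule inj_onI, rule ext)
    fix x y :: "'c chain" and \<sigma> assume "supp x = supp y"
    then have "x \<sigma> = 1 \<longleftrightarrow> y \<sigma> = 1" by (auto simp: supp_def set_eq_iff)
    then show "x \<sigma> = y \<sigma>" by (metis bit_not_one_iff)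
  qed
qed (use assms in \<open>auto simp: Span_def\<close>)

text \<open>Every chain in \<open>Span A\<close> is the sum of the unit chains of its
  support.\<close>

lemma Span_subset_add_closed:
  fixes A :: "'c set"
  assumes "finite A" and U: "add_closed U" and "\<And>\<sigma>. \<sigma> \<in> A \<Longrightarrow> single \<sigma> \<in> U"
  shows "Span A \<subseteq> U"
proof
  fix x :: "'c chain" assume x: "x \<in> Span A"
  have "x = (\<Sum>\<sigma>\<in>supp x. single \<sigma>)"
  proof (rule ext)
    fix \<tau>
    have fin: "finite (supp x)" using x \<open>finite A\<close> by (auto simp: Span_def intro: finite_subset)
    show "x \<tau> = (\<Sum>\<sigma>\<in>supp x. single \<sigma>) \<tau>"
      unfolding chain_sum_apply single_apply using fin by (auto simp: supp_def)
  qed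
  moreover have "(\<Sum>\<sigma>\<in>supp x. single \<sigma>) \<in> U"
    using assms x by (intro add_closed_sum) (auto simp: Span_def)
  ultimately show "x \<in> U" by simp
qed

lemma proj_in_Span [simp]: "proj A x \<in> Span A"
  by (simp add: in_Span_iff proj_def)

lemma proj_add: "proj A (x + y) = proj A x + proj A y"
  by (auto simp: proj_def)

lemma proj_eq_0_iff: "proj A x = 0 \<longleftrightarrow> (\<forall>\<sigma>\<in>A. x \<sigma> = 0)"
  by (auto simp: proj_def fun_eq_iff)

lemma inj_on_if_additive:
  fixes D :: "'c chain \<Rightarrow> 'd chain"
  assumes "\<And>x y. D (x + y) = D x + D y" and "add_closed U"
    and "\<And>x. x \<in> U \<Longrightarrow> D x = 0 \<Longrightarrow> x = 0"
  shows "inj_on D U"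
proof (rule inj_onI)
  fix x y :: "'c chain" assume "x \<in> U" "y \<in> U" "D x = D y"
  then have "D (x + y) = 0" "x + y \<in> U" using assms(1,2) by (auto simp: add_closed_add)
  then show "x = y" using assms(3) chain_add_eq_0_iff by blast
qed

lemma add_closed_image:
  assumes D: "\<And>x y. D (x + y) = D x + (D y :: 'd chain)" and U: "add_closed (U :: 'c chain set)"
  shows "add_closed (D ` U)"
proof -
  have "D 0 = 0" using D[of 0 0] by (simp add: chain_add_eq_0_iff)
  then have "0 \<in> D ` U" using U add_closed_zero by force
  moreover have "D x + D y \<in> D ` U" if "x \<in> U" "y \<in> U" for x y
    using that U add_closed_add[of U x y] by (simp flip: D)
  ultimately show ?thesis by (auto simp: add_closed_def)
qed

lemma add_closed_vimage:
  assumes D: "\<And>x y. D (x + y) = D x + (D y :: 'd chain)" and U: "add_closed U"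
  shows "add_closed {x :: 'c chain. D x \<in> U}"
proof -
  have "D 0 = 0" using D[of 0 0] by (simp add: chain_add_eq_0_iff)
  then show ?thesis using U by (auto simp: add_closed_def D)
qed

text \<open>\<open>P\<close> is a minimal subset of \<open>B\<close> on which no nonzero element of
  \<open>V\<close> vanishes, like the pivot columns of a row space. Injectivity is immediate;
  minimality gives surjectivity.\<close>

lemma row_basis:
  fixes V :: "'c chain set"
  assumes "finite B" and V: "add_closed V" and inj: "\<And>v. v \<in> V \<Longrightarrow> proj B v = 0 \<Longrightarrow> v = 0"
  obtains P where "P \<subseteq> B" "bij_betw (proj P) V (Span P)"
proof -
  define good where "good P \<longleftrightarrow> P \<subseteq> B \<and> (\<forall>v\<in>V. proj P v = 0 \<longrightarrow> v = 0)" for P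
  have "finite {P. good P}" "{P. good P} \<noteq> {}"
    using assms by (auto simp: good_def intro: finite_subset[of _ "Pow B"])
  from finite_has_minimal[OF this]
  obtain P where P: "good P" and minimal: "\<And>P'. good P' \<Longrightarrow> P' \<subseteq> P \<Longrightarrow> P = P'"
    by auto
  have "inj_on (proj P) V"
    using P V by (intro inj_on_if_additive proj_add) (auto simp: good_def)
  moreover have "Span P \<subseteq> proj P ` V"
  proof (rule Span_subset_add_closed)
    show "finite P" using P assms(1) by (auto simp: good_def intro: finite_subset)
    show "add_closed (proj P ` V)" by (rule add_closed_image[OF proj_add V])
  next
    fix p assume p: "p \<in> P"
    \<comment> \<open>Dropping \<open>p\<close> lets some nonzero \<open>v\<close> vanish on the
      rest of \<open>P\<close>; as \<open>v\<close> does not vanish on all of \<open>P\<close>, its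
      projection is the unit chain at \<open>p\<close>.\<close>
    then have "\<not> good (P - {p})" using minimal[of "P - {p}"] by auto
    then obtain v where v: "v \<in> V" "proj (P - {p}) v = 0" "v \<noteq> 0"
      using P by (auto simp: good_def)
    then have "proj P v \<noteq> 0" using P by (auto simp: good_def)
    then have "v p = 1" using v(2) unfolding proj_eq_0_iff by (metis DiffI bit_not_zero_iff singletonD)
    then have "proj P v = single p"
      using v(2) p unfolding proj_eq_0_iff by (auto simp: proj_def single_def fun_eq_iff)
    then show "single p \<in> proj P ` V" using v(1) by (metis imageI)
  qed
  ultimately have "bij_betw (proj P) V (Span P)" by (auto simp: bij_betw_def)
  then show thesis using that P by (auto simp: good_def)
qed

text \<open>Extension of an independent set to a basis: \<open>S\<close> is maximal among the sets
  between \<open>S0\<close> and \<open>R\<close> on whose span \<open>D\<close> has trivial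
  kernel.\<close>

lemma column_basis:
  fixes D :: "'c chain \<Rightarrow> 'd chain"
  assumes D: "\<And>x y. D (x + y) = D x + D y" and "finite R" "S0 \<subseteq> R"
    and inj: "\<And>x. x \<in> Span S0 \<Longrightarrow> D x = 0 \<Longrightarrow> x = 0"
  obtains S where "S0 \<subseteq> S" "S \<subseteq> R" "bij_betw D (Span S) (D ` Span R)"
proof -
  define good where "good S \<longleftrightarrow> S0 \<subseteq> S \<and> S \<subseteq> R \<and> (\<forall>x\<in>Span S. D x = 0 \<longrightarrow> x = 0)" for S
  have "finite {S. good S}"
    by (rule finite_subset[of _ "Pow R"]) (use \<open>finite R\<close> in \<open>auto simp: good_def\<close>)
  moreover have "good S0" unfolding good_def using \<open>S0 \<subseteq> R\<close> inj by blast
  then have "{S. good S} \<noteq> {}" by blast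
  ultimately
  obtain S where S: "good S" and maximal: "\<And>S'. good S' \<Longrightarrow> S \<subseteq> S' \<Longrightarrow> S = S'"
    using finite_has_maximal[of "{S. good S}"] by (metis mem_Collect_eq)
  have SR: "S \<subseteq> R" using S by (simp add: good_def)
  have "inj_on D (Span S)"
    by (rule inj_on_if_additive[of D, OF D add_closed_Span]) (use S in \<open>simp add: good_def\<close>)
  moreover have "Span R \<subseteq> {x. D x \<in> D ` Span S}"
  proof (rule Span_subset_add_closed[OF \<open>finite R\<close>])
    show "add_closed {x. D x \<in> D ` Span S}"
      by (rule add_closed_vimage[of D, OF D add_closed_image[of D, OF D add_closed_Span]])
  next
    fix r assume r: "r \<in> R"
    show "single r \<in> {x. D x \<in> D ` Span S}"
    proof (cases "r \<in> S")
      case False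
      \<comment> \<open>By maximality some kernel element \<open>x\<close> involves
        \<open>r\<close>; cancelling \<open>r\<close> from it expresses \<open>D (single r)\<close>
        through the cells of \<open>S\<close>.\<close>
      then have "\<not> good (insert r S)" using maximal[of "insert r S"] by auto
      then obtain x where x: "x \<in> Span (insert r S)" "D x = 0" "x \<noteq> 0"
        using S r by (auto simp: good_def)
      then have "x \<notin> Span S" using S by (auto simp: good_def)
      then have "x r = 1" using x(1) unfolding in_Span_iff by (metis bit_not_zero_iff insertE)
      then have "x + single r \<in> Span S" using x(1) by (auto simp: in_Span_iff single_apply)
      moreover have "D (x + single r) = D (single r)" using x(2) by (simp add: D)
      ultimately show ?thesis by (metis imageI mem_Collect_eq)
    qed auto
  qed
  ultimately have "bij_betw D (Span S) (D ` Span R)"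
    using Span_mono[OF SR] by (auto simp: bij_betw_def)
  then show thesis using that S by (auto simp: good_def)
qed

section \<open>The boundary map\<close>

lemma bd_add: "bd K (x + y) = bd K x + bd K y"
  by (auto simp: bd_def fun_eq_iff distrib_right sum.distrib)

lemma bd_zero [simp]: "bd K 0 = 0"
  by (auto simp: bd_def)

lemma bd_in_Span_cells [simp]: "bd K x \<in> Span (cells K)"
  by (simp add: in_Span_iff bd_def)

lemma qcells_subset: "qcells K q \<subseteq> cells K"
  by (auto simp: qcells_def)

lemma add_closed_cycles: "add_closed (cycles K q)"
  using add_closed_Span[of "qcells K q"] by (auto simp: add_closed_def cycles_def bd_add)

lemma add_closed_boundaries: "add_closed (boundaries K q)"
  unfolding boundaries_def by (intro add_closed_image bd_add add_closed_Span)

context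
  fixes n :: nat and K :: "'c cellular"
  assumes K: "cell_complex n K"
begin

lemma finite_cells: "finite (cells K)"
  using K by (simp add: cell_complex_def)

lemma inc_eq_0: "\<sigma> \<in> cells K \<Longrightarrow> \<tau> \<in> cells K \<Longrightarrow> cdim K \<sigma> \<noteq> Suc (cdim K \<tau>) \<Longrightarrow> inc K \<sigma> \<tau> = 0"
  using K unfolding cell_complex_def by blast

lemma bd_bd: "x \<in> Span (cells K) \<Longrightarrow> bd K (bd K x) = 0"
  using K by (simp add: cell_complex_def)

text \<open>The boundary map lowers dimension by exactly one, so it commutes with taking homogeneous
  parts.\<close>

lemma bd_proj_qcells: "bd K (proj (qcells K (Suc q)) x) = proj (qcells K q) (bd K x)"
proof (rule ext)
  fix \<tau>
  have eq: "(\<Sum>\<sigma>\<in>cells K. proj (qcells K (Suc q)) x \<sigma> * inc K \<sigma> \<tau>) =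
      (if cdim K \<tau> = q then \<Sum>\<sigma>\<in>cells K. x \<sigma> * inc K \<sigma> \<tau> else 0)" if "\<tau> \<in> cells K"
  proof (cases "cdim K \<tau> = q")
    case True
    then have "proj (qcells K (Suc q)) x \<sigma> * inc K \<sigma> \<tau> = x \<sigma> * inc K \<sigma> \<tau>" if "\<sigma> \<in> cells K" for \<sigma>
      using that \<open>\<tau> \<in> cells K\<close> inc_eq_0[of \<sigma> \<tau>] by (auto simp: proj_def qcells_def)
    then show ?thesis using True by (auto intro: sum.cong)
  next
    case False
    then have "proj (qcells K (Suc q)) x \<sigma> * inc K \<sigma> \<tau> = 0" if "\<sigma> \<in> cells K" for \<sigma>
      using that \<open>\<tau> \<in> cells K\<close> inc_eq_0[of \<sigma> \<tau>] by (auto simp: proj_def qcells_def)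
    then show ?thesis using False by (auto intro: sum.neutral)
  qed
  show "bd K (proj (qcells K (Suc q)) x) \<tau> = proj (qcells K q) (bd K x) \<tau>"
    using eq unfolding bd_def proj_def[of "qcells K q"] by (auto simp: qcells_def)
qed

lemma bd_qcells_0: "bd K (proj (qcells K 0) x) = 0"
proof (rule ext)
  fix \<tau>
  have "proj (qcells K 0) x \<sigma> * inc K \<sigma> \<tau> = 0" if "\<sigma> \<in> cells K" "\<tau> \<in> cells K" for \<sigma>
    using that inc_eq_0[of \<sigma> \<tau>] by (auto simp: proj_def qcells_def)
  then show "bd K (proj (qcells K 0) x) \<tau> = 0 \<tau>" by (simp add: bd_def)
qed

text \<open>Follows from \<open>bd_proj_qcells\<close>; degree 0 is separate because no cells lie
  below it.\<close>

lemma proj_cycle: "bd K x = 0 \<Longrightarrow> proj (qcells K q) x \<in> cycles K q"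
  by (cases q) (auto simp: cycles_def bd_qcells_0 bd_proj_qcells proj_eq_0_iff)

lemma boundaries_subset_cycles: "boundaries K q \<subseteq> cycles K q"
proof
  fix z assume "z \<in> boundaries K q"
  then obtain y where y: "y \<in> Span (qcells K (Suc q))" "z = bd K y" by (auto simp: boundaries_def)
  have "proj (qcells K (Suc q)) y = y" using y(1) by (auto simp: proj_def in_Span_iff)
  then have "z = proj (qcells K q) z" using bd_proj_qcells[of q y] y(2) by simp
  then show "z \<in> cycles K q"
    using y bd_bd Span_mono[OF qcells_subset] unfolding cycles_def
    by (metis (mono_tags, lifting) mem_Collect_eq proj_in_Span subsetD)
qed

text \<open>A preimage \<open>y\<close> of mixed dimensions can be replaced by its part of dimension
  \<open>q + 1\<close>.\<close>

lemma homogeneous_boundary: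
  assumes "y \<in> Span (cells K)" "bd K y \<in> Span (qcells K q)"
  shows "bd K y \<in> boundaries K q"
proof -
  have "proj (qcells K q) (bd K y) = bd K y" using assms(2) by (auto simp: proj_def in_Span_iff)
  then have "bd K y = bd K (proj (qcells K (Suc q)) y)" by (simp add: bd_proj_qcells)
  then show ?thesis unfolding boundaries_def by (metis imageI proj_in_Span)
qed

section \<open>Perfect vector fields with prescribed cycles\<close>

text \<open>The hypotheses \<open>gen\<close> and \<open>indep\<close> say in terms of subset sums
  that the \<open>b i\<close> form a homology basis; \<open>supported\<close>,
  \<open>\<gamma>\<close> and \<open>\<gamma>_other\<close> carry the explicitness.\<close>

lemma perfect_hdvf_from_cycles:
  fixes b :: "nat \<Rightarrow> 'c chain" and I q
  defines "A \<equiv> (\<Union>i\<in>I. supp (b i))"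
  assumes b: "\<And>i. i \<in> I \<Longrightarrow> b i \<in> cycles K q"
    and gen: "\<And>z. z \<in> cycles K q \<Longrightarrow> \<exists>T\<subseteq>I. z + (\<Sum>i\<in>T. b i) \<in> boundaries K q"
    and indep: "\<And>T. T \<subseteq> I \<Longrightarrow> (\<Sum>i\<in>T. b i) \<in> boundaries K q \<Longrightarrow> T = {}"
    and supported: "\<And>z. z \<in> Span A \<Longrightarrow> bd K z = 0 \<Longrightarrow> \<exists>T\<subseteq>I. z = (\<Sum>i\<in>T. b i)"
    and \<gamma>: "\<And>i. i \<in> I \<Longrightarrow> \<gamma> i \<in> supp (b i)"
    and \<gamma>_other: "\<And>i j. i \<in> I \<Longrightarrow> j \<in> I \<Longrightarrow> i \<noteq> j \<Longrightarrow> \<gamma> i \<notin> supp (b j)"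
    and finI: "finite I"
  obtains P S C where "perfect_hdvf K (P, S, C)" "\<gamma> ` I = C \<inter> qcells K q"
    "\<And>i. i \<in> I \<Longrightarrow> fst (snd (hdvf_reduction K (P, S, C))) (single (\<gamma> i)) = b i"
proof -
  \<comment> \<open>Boundaries of all degrees together, so that one choice of \<open>P\<close> and
    \<open>S\<close> serves every dimension.\<close>
  define V where "V = bd K ` Span (cells K)"
  have V: "add_closed V" unfolding V_def by (intro add_closed_image bd_add add_closed_Span)
  have Aq: "A \<subseteq> qcells K q" using b by (auto simp: A_def cycles_def Span_def)
  have AK: "A \<subseteq> cells K" by (rule subset_trans[OF Aq qcells_subset])
  have b_coeff: "b j (\<gamma> i) = (if i = j then 1 else 0)" if "i \<in> I" "j \<in> I" for i j
    using \<gamma>[of i] \<gamma>_other[of i j] that by (auto simp: supp_def)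
  have b_nz: "b i \<noteq> 0" if "i \<in> I" for i using \<gamma>[OF that] by auto
  have b_bd: "bd K (b i) = 0" if "i \<in> I" for i using b[OF that] by (simp add: cycles_def)
  have \<gamma>A: "\<gamma> i \<in> A" if "i \<in> I" for i using \<gamma> that by (auto simp: A_def)
  have bA: "b i \<in> Span A" if "i \<in> I" for i using that by (auto simp: A_def Span_def)

  obtain P where P: "P \<subseteq> cells K - A" and bijP: "bij_betw (proj P) V (Span P)"
  proof (rule row_basis[OF _ V])
    show "finite (cells K - A)" using finite_cells by simp
  next
    fix v assume "v \<in> V" and v0: "proj (cells K - A) v = 0"
    then obtain y where y: "y \<in> Span (cells K)" "v = bd K y" by (auto simp: V_def)
    have "v \<in> Span (cells K)" using y by simp
    then have vA: "v \<in> Span A" using v0 by (auto simp: in_Span_iff proj_eq_0_iff)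
    \<comment> \<open>A boundary supported in \<open>A\<close> is a \<open>q\<close>-boundary and a
      sum of \<open>b i\<close>; independence leaves only the empty sum.\<close>
    then have "v \<in> boundaries K q"
      using homogeneous_boundary[OF y(1)] y(2) Span_mono[OF Aq] by auto
    moreover obtain T where "T \<subseteq> I" "v = (\<Sum>i\<in>T. b i)"
      using supported[OF vA] y bd_bd by auto
    ultimately show "v = 0" using indep[of T] by auto
  qed

  define R where "R = cells K - P"
  have AR: "A \<subseteq> R" using P AK by (auto simp: R_def)
  have V_inj: "v = w" if "v \<in> V" "w \<in> V" "proj P v = proj P w" for v w
    using bijP that by (auto simp: bij_betw_def inj_on_def)

  have bd_R: "bd K ` Span R = V"
  proof
    show "bd K ` Span R \<subseteq> V" unfolding V_def by (intro image_mono Span_mono) (auto simp: R_def)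
    show "V \<subseteq> bd K ` Span R"
    proof
      fix v assume "v \<in> V"
      then obtain y where y: "y \<in> Span (cells K)" "v = bd K y" by (auto simp: V_def)
      \<comment> \<open>Subtracting the boundary with the same \<open>P\<close>-coordinates moves
        \<open>y\<close> into \<open>Span R\<close> and does not change
        \<open>bd K y\<close>.\<close>
      have "proj P y \<in> proj P ` V" using bijP by (simp add: bij_betw_def)
      then obtain w where w: "w \<in> Span (cells K)" "proj P y = proj P (bd K w)"
        by (auto simp: V_def)
      have "proj P (y + bd K w) = 0" using w by (simp add: proj_add)
      moreover have "y + bd K w \<in> Span (cells K)"
        using y by (intro add_closed_add[OF add_closed_Span]) auto
      ultimately have "y + bd K w \<in> Span R"
        unfolding R_def by (auto simp: in_Span_iff proj_eq_0_iff)
      moreover have "bd K (y + bd K w) = v" using y w bd_bd by (simp add: bd_add)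
      ultimately show "v \<in> bd K ` Span R" by (metis imageI)
    qed
  qed

  obtain S where S: "A - \<gamma> ` I \<subseteq> S" "S \<subseteq> R" and bijS: "bij_betw (bd K) (Span S) V"
  proof (rule column_basis[of "bd K" R "A - \<gamma> ` I"])
    show "finite R" using finite_cells by (simp add: R_def)
    show "A - \<gamma> ` I \<subseteq> R" using AR by blast
  next
    fix x assume x: "x \<in> Span (A - \<gamma> ` I)" "bd K x = 0"
    then obtain T where T: "T \<subseteq> I" "x = (\<Sum>i\<in>T. b i)"
      using supported[of x] Span_mono[of "A - \<gamma> ` I" A] by auto
    have "T = {}"
    proof (rule ccontr)
      assume "T \<noteq> {}"
      then obtain i where i: "i \<in> T" by blast
      \<comment> \<open>Only \<open>b i\<close> has \<open>\<gamma> i\<close> in its support, so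
        this coefficient is 1, while \<open>x\<close> avoids all private cells.\<close>
      have "x (\<gamma> i) = (\<Sum>j\<in>T. if i = j then 1 else 0)"
        unfolding T(2) chain_sum_apply using T(1) i b_coeff by (intro sum.cong refl) blast
      also have "\<dots> = 1" using i finite_subset[OF T(1) finI] by simp
      finally show False using x(1) i T(1) by (auto simp: in_Span_iff)
    qed
    then show "x = 0" using T by simp
  qed (auto simp: bd_add bd_R)

  define C where "C = R - S"
  have bijSP: "bij_betw (bd_block K S P) (Span S) (Span P)"
  proof -
    \<comment> \<open>Composition of the bijections from \<open>Span S\<close> to \<open>V\<close>
      and from \<open>V\<close> to \<open>Span P\<close>.\<close>
    have "bd_block K S P = proj P \<circ> bd K" by (auto simp: bd_block_def fun_eq_iff)
    then show ?thesis using bij_betw_trans[OF bijS bijP] by simp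
  qed
  then have hdvf: "hdvf K (P, S, C)"
    using P S by (auto simp: hdvf_def C_def R_def)
  define H where "H = hdvf_H K (P, S, C)"
  have H_eqI: "H x = s" if "s \<in> Span S" "bd_block K S P s = x" for x s
    using bijSP that unfolding H_def hdvf_H_def by (auto simp: bij_betw_def)
  have H_in: "H x \<in> Span S" and block_H: "bd_block K S P (H x) = x" if "x \<in> Span P" for x
    using bijSP that unfolding H_def hdvf_H_def
    by (auto simp: bij_betw_def f_inv_into_f intro!: inv_into_into)
  \<comment> \<open>Modulo 2 this is \<open>hdvf_G\<close>. Boundaries are determined by their
    coordinates on \<open>P\<close>, so for a chain \<open>x\<close> of \<open>K\<close>,
    \<open>lift x\<close> is the chain in \<open>Span S\<close> with the same boundary, and
    \<open>x + lift x\<close> is a cycle.\<close>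
  define lift where "lift x = H (bd_block K C P x)" for x
  have lift_in: "lift x \<in> Span S" for x
    unfolding lift_def by (intro H_in) (simp add: bd_block_def)
  have bd_lift: "bd K (lift x) = bd K x" if "x \<in> Span (cells K)" for x
  proof (rule V_inj)
    show "bd K (lift x) \<in> V" using lift_in[of x] bijS by (auto simp: bij_betw_def)
    show "bd K x \<in> V" using that by (auto simp: V_def)
    show "proj P (bd K (lift x)) = proj P (bd K x)"
      using block_H[of "bd_block K C P x"] by (simp add: lift_def bd_block_def)
  qed
  have CK: "C \<subseteq> cells K" by (auto simp: C_def R_def)

  \<comment> \<open>The reduced boundary is the \<open>C\<close>-part of
    \<open>bd K x - bd K (lift x)\<close>, which is zero.\<close>
  have "hdvf_d K (P, S, C) x = 0" if "x \<in> Span C" for x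
  proof -
    have "x \<in> Span (cells K)" using that Span_mono[OF CK] by auto
    then show ?thesis
      using bd_lift[of x] by (simp add: hdvf_d_def bd_block_def lift_def H_def)
  qed
  then have perfect: "perfect_hdvf K (P, S, C)" using hdvf by (simp add: perfect_hdvf_def)

  \<comment> \<open>Otherwise all cells of \<open>b i\<close> would lie in \<open>S\<close>, making
    it a nonzero cycle in \<open>Span S\<close>, where \<open>bd K\<close> is injective.\<close>
  have \<gamma>C: "\<gamma> i \<in> C" if i: "i \<in> I" for i
  proof -
    have "\<gamma> i \<notin> S"
    proof
      assume "\<gamma> i \<in> S"
      moreover have "\<gamma> j \<notin> supp (b i)" if "j \<in> I" "j \<noteq> i" for j
        using \<gamma>_other that i by blast
      ultimately have "supp (b i) \<subseteq> S" using S(1) i by (auto simp: A_def)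
      then have "b i \<in> Span S" by (simp add: Span_def)
      moreover have "bd K (b i) = bd K 0" "0 \<in> Span S"
        using b_bd i by (auto simp: in_Span_iff)
      ultimately have "b i = 0" using bij_betw_imp_inj_on[OF bijS] by (metis inj_onD)
      then show False using b_nz i by blast
    qed
    then show ?thesis using \<gamma>A[OF i] AR by (auto simp: C_def)
  qed

  have "\<gamma> ` I = C \<inter> qcells K q"
  proof
    show "\<gamma> ` I \<subseteq> C \<inter> qcells K q" using \<gamma>C \<gamma>A Aq by auto
    show "C \<inter> qcells K q \<subseteq> \<gamma> ` I"
    proof
      fix c assume c: "c \<in> C \<inter> qcells K q"
      \<comment> \<open>The \<open>q\<close>-part of the cycle that \<open>g\<close> assigns to
        \<open>c\<close>; taking this part yields a \<open>q\<close>-cycle whether or not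
        \<open>lift\<close> preserves dimension.\<close>
      define z where "z = proj (qcells K q) (single c + lift (single c))"
      have "single c \<in> Span (cells K)" using c CK by auto
      then have "bd K (single c + lift (single c)) = 0" by (simp add: bd_add bd_lift)
      then obtain T where T: "T \<subseteq> I" "z + (\<Sum>i\<in>T. b i) \<in> boundaries K q"
        using gen proj_cycle unfolding z_def by blast
      have zR: "z \<in> Span R"
        using c lift_in[of "single c"] S(2) unfolding z_def
        by (auto simp: in_Span_iff proj_def single_apply C_def)
      have "(\<Sum>i\<in>T. b i) \<in> Span R"
        using T(1) bA Span_mono[OF AR] by (intro add_closed_sum add_closed_Span) auto
      with zR have "z + (\<Sum>i\<in>T. b i) \<in> Span R" by (intro add_closed_add add_closed_Span)
      \<comment> \<open>A chain in \<open>Span R\<close> has no coordinates on \<open>P\<close>, so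
        a boundary in \<open>Span R\<close> is zero.\<close>
      then have "proj P (z + (\<Sum>i\<in>T. b i)) = proj P 0"
        by (auto simp: in_Span_iff proj_def R_def fun_eq_iff simp del: plus_fun_apply)
      moreover have "z + (\<Sum>i\<in>T. b i) \<in> V"
        using T(2) Span_mono[OF qcells_subset] unfolding V_def boundaries_def by blast
      ultimately have "z + (\<Sum>i\<in>T. b i) = 0"
        using V_inj add_closed_zero[OF V] by blast
      then have "z = (\<Sum>i\<in>T. b i)" by (simp only: chain_add_eq_0_iff)
      also have "\<dots> \<in> Span A" using T(1) bA by (intro add_closed_sum add_closed_Span) auto
      finally have "z \<in> Span A" .
      moreover have "z c = 1"
        using c lift_in[of "single c"] by (auto simp: z_def proj_def single_apply C_def in_Span_iff)
      ultimately have "c \<in> A" by (auto simp: in_Span_iff)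
      \<comment> \<open>All of \<open>A\<close> except the private cells lies in \<open>S\<close>,
        which is disjoint from \<open>C\<close>.\<close>
      then show "c \<in> \<gamma> ` I" using c S(1) by (auto simp: C_def)
    qed
  qed
  moreover have "fst (snd (hdvf_reduction K (P, S, C))) (single (\<gamma> i)) = b i" if i: "i \<in> I" for i
  proof -
    \<comment> \<open>Deleting its private cell from \<open>b i\<close> leaves a chain in
      \<open>Span S\<close> with the same boundary as that cell; this is the lift.\<close>
    have "supp (b i + single (\<gamma> i)) \<subseteq> A - \<gamma> ` I"
    proof
      fix \<sigma> assume \<sigma>: "\<sigma> \<in> supp (b i + single (\<gamma> i))"
      then have "\<sigma> \<noteq> \<gamma> i" using b_coeff[OF i i] by (auto simp: supp_def single_apply)
      then have "\<sigma> \<in> supp (b i)" using \<sigma> supp_add_subset by fastforce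
      then show "\<sigma> \<in> A - \<gamma> ` I" using \<open>\<sigma> \<noteq> \<gamma> i\<close> \<gamma>_other i by (auto simp: A_def)
    qed
    then have "b i + single (\<gamma> i) \<in> Span S" using S(1) by (auto simp: Span_def)
    then have "lift (single (\<gamma> i)) = b i + single (\<gamma> i)"
      unfolding lift_def using b_bd[OF i] by (intro H_eqI) (simp_all add: bd_block_def bd_add)
    then show ?thesis
      by (simp add: hdvf_reduction_def hdvf_G_def lift_def H_def add.left_commute)
  qed
  ultimately show thesis using that perfect by blast
qed

end

section \<open>Explicit homology bases\<close>

lemma subcomplex_simps [simp]: "cdim (subcomplex K A) = cdim K" "inc (subcomplex K A) = inc K"
  by (simp_all add: subcomplex_def)

lemma subset_cells_subcomplex: "A \<subseteq> cells (subcomplex K A)"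
  by (auto simp: subcomplex_def)

lemma cells_subcomplex_subset:
  assumes "A \<subseteq> B" "B \<subseteq> cells K" "\<And>\<sigma>. \<sigma> \<in> B \<Longrightarrow> supp (bd K (single \<sigma>)) \<subseteq> B"
  shows "cells (subcomplex K A) \<subseteq> B"
  using assms by (auto simp: subcomplex_def)

text \<open>\<open>cells K\<close> is itself a member of the family being intersected.\<close>

lemma cells_subcomplex: "A \<subseteq> cells K \<Longrightarrow> cells (subcomplex K A) \<subseteq> cells K"
  using bd_in_Span_cells[of K] by (intro cells_subcomplex_subset) (auto simp: Span_def)

text \<open>The cells of dimension at most \<open>q\<close> contain \<open>A\<close> and are closed
  under faces. Consequently the subcomplex has no nonzero \<open>q\<close>-boundaries.\<close>

lemma qcells_Suc_subcomplex:
  assumes K: "cell_complex n K" and A: "A \<subseteq> qcells K q"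
  shows "qcells (subcomplex K A) (Suc q) = {}"
proof -
  have fin: "finite (cells K)" by (rule finite_cells[OF K])
  have "cells (subcomplex K A) \<subseteq> {\<sigma> \<in> cells K. cdim K \<sigma> \<le> q}"
  proof (rule cells_subcomplex_subset)
    fix \<sigma> assume \<sigma>: "\<sigma> \<in> {\<sigma> \<in> cells K. cdim K \<sigma> \<le> q}"
    show "supp (bd K (single \<sigma>)) \<subseteq> {\<sigma> \<in> cells K. cdim K \<sigma> \<le> q}"
    proof
      fix \<tau> assume "\<tau> \<in> supp (bd K (single \<sigma>))"
      then have \<tau>: "\<tau> \<in> cells K" and "(\<Sum>\<rho>\<in>cells K. single \<sigma> \<rho> * inc K \<rho> \<tau>) \<noteq> 0"
        by (auto simp: supp_def bd_def split: if_splits)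
      then obtain \<rho> where "\<rho> \<in> cells K" "single \<sigma> \<rho> * inc K \<rho> \<tau> \<noteq> 0"
        by (meson sum.not_neutral_contains_not_neutral)
      then have "inc K \<sigma> \<tau> \<noteq> 0" by (auto simp: single_apply split: if_splits)
      then have "cdim K \<sigma> = Suc (cdim K \<tau>)" using inc_eq_0[OF K] \<sigma> \<tau> by blast
      then show "\<tau> \<in> {\<sigma> \<in> cells K. cdim K \<sigma> \<le> q}" using \<sigma> \<tau> by auto
    qed
  qed (use A in \<open>auto simp: qcells_def\<close>)
  then show ?thesis by (auto simp: qcells_def)
qed

text \<open>All cells of \<open>z\<close> belong to the subcomplex, so its boundary coefficients
  there are the same sums as in \<open>K\<close>.\<close>

lemma supported_cycle_in_cycles_subcomplex:
  assumes K: "cell_complex n K" and A: "A \<subseteq> qcells K q" and z: "z \<in> Span A" "bd K z = 0"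
  shows "z \<in> cycles (subcomplex K A) q"
proof -
  let ?L = "subcomplex K A"
  have LK: "cells ?L \<subseteq> cells K" by (rule cells_subcomplex[OF subset_trans[OF A qcells_subset]])
  have "z \<in> Span (qcells ?L q)"
    using z(1) A subset_cells_subcomplex[of A K] by (auto simp: in_Span_iff qcells_def)
  moreover have "bd ?L z = 0"
  proof (rule ext)
    fix \<tau>
    have "(\<Sum>\<sigma>\<in>cells ?L. z \<sigma> * inc K \<sigma> \<tau>) = (\<Sum>\<sigma>\<in>cells K. z \<sigma> * inc K \<sigma> \<tau>)"
      using finite_cells[OF K] LK z(1) subset_cells_subcomplex[of A K]
      by (intro sum.mono_neutral_left) (auto simp: in_Span_iff)
    then show "bd ?L z \<tau> = 0 \<tau>"
      using fun_cong[OF z(2), of \<tau>] LK by (auto simp: bd_def)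
  qed
  ultimately show ?thesis by (simp add: cycles_def)
qed

text \<open>The inclusion is a premise: for \<open>K\<close> it follows from \<open>bd_bd\<close>,
  for the subcomplex from the absence of nonzero \<open>q\<close>-boundaries.\<close>

lemma chain_quotient_homology:
  "boundaries K q \<subseteq> cycles K q \<Longrightarrow> chain_quotient (cycles K q) (boundaries K q)"
  by (unfold_locales) (simp_all add: add_closed_cycles add_closed_boundaries)

theorem theorem2:
  fixes K :: "'c cellular" and n q :: nat and b :: "nat \<Rightarrow> 'c chain"
  assumes "cell_complex n K"
    and "q \<le> n"
    and "explicit_homology_basis K q b"
  shows "\<exists>P S C f g h. perfect_hdvf K (P, S, C) \<and>
           (f, g, h) = hdvf_reduction K (P, S, C) \<and>
           (\<exists>\<gamma>. bij_betw \<gamma> {1..betti K q} (C \<inter> qcells K q) \<and>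
                (\<forall>i\<in>{1..betti K q}. g (single (\<gamma> i)) = b i))"
proof -
  note K = assms(1)
  define I where "I = {1..betti K q}"
  define A where "A = (\<Union>i\<in>I. supp (b i))"
  define L where "L = subcomplex K A"
  have finI: "finite I" by (simp add: I_def)
  have b: "\<And>i. i \<in> I \<Longrightarrow> b i \<in> cycles K q"
    and inj: "inj_on (\<lambda>i. hclass K q (b i)) I"
    and basis: "vectorspace.basis class_ring (homology K q) ((\<lambda>i. hclass K q (b i)) ` I)"
    and private_cells: "\<forall>k\<in>I. supp (b k) - (\<Union>i\<in>I - {k}. supp (b i)) \<noteq> {}"
    and betti_L: "betti L q = betti K q"
    using assms(3)
    by (auto simp: explicit_homology_basis_def homology_basis_def I_def A_def L_def)
  have Aq: "A \<subseteq> qcells K q" using b by (auto simp: A_def cycles_def Span_def)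

  interpret HK: chain_quotient "cycles K q" "boundaries K q"
    by (intro chain_quotient_homology boundaries_subset_cycles[OF K])
  have gen: "\<exists>T\<subseteq>I. z + (\<Sum>i\<in>T. b i) \<in> boundaries K q" if "z \<in> cycles K q" for z
    using HK.span_Q_mem[of I b z] finI inj b basis that by (simp add: hclass_def homology_def)
  have indep: "T = {}" if "T \<subseteq> I" "(\<Sum>i\<in>T. b i) \<in> boundaries K q" for T
  proof -
    have "\<not> module.lin_dep class_ring (homology K q) ((\<lambda>i. hclass K q (b i)) ` I)"
      using basis vectorspace.basis_def[OF HK.vectorspace_Q] by (simp add: homology_def)
    then show ?thesis
      using HK.lin_dep_Q_iff[of I b] finI inj b that by (auto simp: hclass_def homology_def)
  qed

  \<comment> \<open>Homology of \<open>L\<close> in degree \<open>q\<close> is thus its cycle space: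
    each class consists of one cycle.\<close>
  have boundaries_L: "boundaries L q = {0}"
    using qcells_Suc_subcomplex[OF K Aq] by (simp add: boundaries_def L_def Span_empty)
  have bL: "b i \<in> cycles L q" if "i \<in> I" for i
    unfolding L_def using b[OF that] that
    by (intro supported_cycle_in_cycles_subcomplex[OF K Aq]) (auto simp: A_def Span_def cycles_def)
  interpret HL: chain_quotient "cycles L q" "boundaries L q"
    by (rule chain_quotient_homology)
      (simp add: boundaries_L add_closed_zero[OF add_closed_cycles])
  have inj_L: "inj_on (\<lambda>i. hclass L q (b i)) I"
  proof (rule inj_onI)
    fix i j assume ij: "i \<in> I" "j \<in> I" "hclass L q (b i) = hclass L q (b j)"
    then have "b i + b j \<in> boundaries L q" by (simp only: hclass_def HL.cls_eq_iff)
    then have "b i = b j" by (simp only: boundaries_L singleton_iff chain_add_eq_0_iff)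
    then have "hclass K q (b i) = hclass K q (b j)" by simp
    then show "i = j" using inj_onD[OF inj] ij(1,2) by blast
  qed
  have finL: "finite (cycles L q)"
  proof -
    have "cells L \<subseteq> cells K"
      unfolding L_def by (rule cells_subcomplex[OF subset_trans[OF Aq qcells_subset]])
    then have "finite (cells L)" using finite_cells[OF K] by (rule finite_subset)
    then have "finite (qcells L q)" by (rule finite_subset[OF qcells_subset])
    then have "finite (Span (qcells L q))" by (rule finite_Span)
    then show ?thesis by (rule rev_finite_subset) (auto simp: cycles_def)
  qed
  \<comment> \<open>Independence in \<open>L\<close> is inherited from \<open>K\<close>, and as many
    independent classes as the dimension form a basis. Here the dimension condition of explicitness
    enters.\<close>
  have basis_L: "vectorspace.basis class_ring HL.Q ((\<lambda>i. HL.cls (b i)) ` I)"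
  proof (rule vectorspace.dim_li_is_basis[OF HL.vectorspace_Q HL.fin_dim_Q[OF finL]])
    show "finite ((\<lambda>i. HL.cls (b i)) ` I)" using finI by simp
    show "(\<lambda>i. HL.cls (b i)) ` I \<subseteq> carrier HL.Q" using bL by (auto simp: HL.carrier_Q)
    have "boundaries L q \<subseteq> boundaries K q"
      using add_closed_zero[OF add_closed_boundaries] by (simp add: boundaries_L)
    then have "\<not> (\<exists>T\<subseteq>I. T \<noteq> {} \<and> (\<Sum>i\<in>T. b i) \<in> boundaries L q)"
      using indep by blast
    then show "\<not> module.lin_dep class_ring HL.Q ((\<lambda>i. HL.cls (b i)) ` I)"
      using HL.lin_dep_Q_iff[of I b, OF finI inj_L[unfolded hclass_def] bL] by blast
    have "card ((\<lambda>i. HL.cls (b i)) ` I) = betti K q"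
      using inj_L by (simp add: card_image hclass_def I_def)
    then show "vectorspace.dim class_ring HL.Q \<le> card ((\<lambda>i. HL.cls (b i)) ` I)"
      using betti_L by (simp add: betti_def homology_def)
  qed
  \<comment> \<open>Spanning in \<open>L\<close> holds without a boundary correction, so
    \<open>z\<close> equals a subset sum exactly.\<close>
  have supported: "\<exists>T\<subseteq>I. z = (\<Sum>i\<in>T. b i)" if "z \<in> Span A" "bd K z = 0" for z
  proof -
    have "z \<in> cycles L q"
      unfolding L_def using supported_cycle_in_cycles_subcomplex[OF K Aq that] .
    then obtain T where "T \<subseteq> I" "z + (\<Sum>i\<in>T. b i) \<in> boundaries L q"
      using HL.span_Q_mem[OF finI _ bL basis_L] inj_L by (auto simp: hclass_def)
    then show ?thesis by (auto simp: boundaries_L chain_add_eq_0_iff simp del: plus_fun_apply)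
  qed

  \<comment> \<open>Choice of a private cell for each basis cycle.\<close>
  have "\<forall>k\<in>I. \<exists>c. c \<in> supp (b k) - (\<Union>i\<in>I - {k}. supp (b i))"
    using private_cells by (simp only: ex_in_conv)
  from bchoice[OF this]
  obtain \<gamma> where \<gamma>: "\<And>k. k \<in> I \<Longrightarrow> \<gamma> k \<in> supp (b k) - (\<Union>i\<in>I - {k}. supp (b i))"
    by blast
  obtain P S C where PSC: "perfect_hdvf K (P, S, C)" "\<gamma> ` I = C \<inter> qcells K q"
    "\<And>i. i \<in> I \<Longrightarrow> fst (snd (hdvf_reduction K (P, S, C))) (single (\<gamma> i)) = b i"
  proof (rule perfect_hdvf_from_cycles[OF K, of I b q \<gamma>])
    show "\<gamma> i \<notin> supp (b j)" if "i \<in> I" "j \<in> I" "i \<noteq> j" for i j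
      using \<gamma>[OF that(1)] that by auto
  qed (use b gen indep supported \<gamma> finI in \<open>auto simp: A_def\<close>)
  have "inj_on \<gamma> I"
  proof (rule inj_onI, rule ccontr)
    fix i j assume ij: "i \<in> I" "j \<in> I" "\<gamma> i = \<gamma> j" "i \<noteq> j"
    show False using \<gamma>[OF ij(1)] \<gamma>[OF ij(2)] ij by auto
  qed
  then have bij: "bij_betw \<gamma> I (C \<inter> qcells K q)" using PSC(2) by (simp add: bij_betw_def)
  obtain f g h where fgh: "hdvf_reduction K (P, S, C) = (f, g, h)"
    by (rule prod_cases3)
  have "\<forall>i\<in>I. g (single (\<gamma> i)) = b i"
    using PSC(3) by (simp add: fgh)
  with PSC(1) bij fgh[symmetric] show ?thesis unfolding I_def by blast
qed

end
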